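(* Let $\ell,k\ge 0$ be integers and let $\mathcal Q$ be an $\ell$-ary query over a relational input schema $\tau_{\mathrm{in}}$ that is expressible by a semi-positive existential first-order formula with $k$ (existential) quantifiers. Then $\mathcal Q$ can be maintained under insertions in $(\ell+k-1)$-ary $\mathrm{DynProp}$, i.e. by a dynamic program with quantifier-free update formulas all of whose auxiliary relations have arity at most $\ell+k-1$.
   Context: A semi-positive existential first-order formula over a relational schema is a formula of the form $\varphi(\vec y)=\exists \vec x\,\psi(\vec x,\vec y)$, where $\psi$ is quantifier-free and contains no negations except possibly literals of the form $z_i\neq z_j$ between variables; $k=|\vec x|$ is the number of quantifiers. Dynamic complexity framework. A dynamic schema is a pair $(\tau_{\mathrm{in}},\tau_{\mathrm{aux}})$ of an input schema and an auxiliary schema ($\tau_{\mathrm{aux}}$ consists of relation symbols only); put $\tau=\tau_{\mathrm{in}}\cup\tau_{\mathrm{aux}}$. A modification of a database over a finite domain $D$ is an insertion $\mathrm{ins}_S(\vec a)$ or a deletion $\mathrm{del}_S(\vec a)$ of a tuple $\vec a$ over $D$ into/from a relation $S\in\tau_{\mathrm{in}}$. An update program $P$ contains, for each $R\in\tau_{\mathrm{aux}}$ and each $\delta\in\{\mathrm{ins}_S,\mathrm{del}_S\}$ with $S\in\tau_{\mathrm{in}}$, a first-order formula $\varphi^R_\delta(\vec x;\vec y)$ over $\tau$ with $|\vec x|$ the arity of $S$ and $|\vec y|$ the arity of $R$. A program state is a structure $(D,\mathcal I,\mathcal A)$ with $\mathcal I$ an input database and $\mathcal A$ an auxiliary database over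 domain $D$. Applying $\delta(\vec a)$ to a state $\mathcal S$ yields the state in which the input database is modified by $\delta(\vec a)$ and each $R\in\tau_{\mathrm{aux}}$ is reinterpreted as $\{\vec b:\mathcal S\models\varphi^R_\delta(\vec a;\vec b)\}$ (evaluated in the old state $\mathcal S$); sequences of modifications are applied one after another. A dynamic program is a triple $(P,\mathrm{Init},Q)$ with $P$ an update program, $\mathrm{Init}$ an arbitrary mapping from input databases to auxiliary databases over the same domain, and $Q\in\tau_{\mathrm{aux}}$ a designated query symbol. It maintains a query $\mathcal Q$ if for every input database $\mathcal D$ over any finite domain $D$ and every sequence $\alpha$ of modifications, the interpretation of $Q$ in the state obtained from $(D,\mathcal D,\mathrm{Init}(\mathcal D))$ by applying $\alpha$ equals $\mathcal Q(\alpha(\mathcal D))$, where $\alpha(\mathcal D)$ is the database after applying $\alpha$. "Maintained under insertions" means this is required only for sequences $\alpha$ consisting solely of insertions. $\mathrm{DynProp}$ is the class of queries maintainable by dynamic programs whose update formulas are quantifier-free; the program is $m$-ary if all auxiliary relation symbols have arity at most $m$.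
   Formalization: For k = 0 the arity bound is ℓ instead of ℓ−1, since the query symbol is itself an ℓ-ary auxiliary relation and the bound ℓ−1 is unattainable (e.g. for the query R(x)); for every k ≥ 1 the bound is ℓ+k−1 as stated. *)

theory Defs
  imports Main
begin

section \<open>Relational schemas and databases\<close>

text \<open>
  A schema is the partial map sending each of its relation symbols to its arity.
  Relations are sets of lists; a database interprets symbols outside its schema by the
  empty relation, so that it is determined by the interpretation of the schema.
\<close>

type_synonym 'r schema = "'r \<Rightarrow> nat option"
type_synonym ('r, 'a) db = "'r \<Rightarrow> 'a list set"
type_synonym ('r, 'a) query = "'a set \<Rightarrow> ('r, 'a) db \<Rightarrow> 'a list set"

definition tuples :: "'a set \<Rightarrow> nat \<Rightarrow> 'a list set" where
  "tuples D n = {t. set t \<subseteq> D \<and> length t = n}"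

definition is_db :: "'r schema \<Rightarrow> 'a set \<Rightarrow> ('r, 'a) db \<Rightarrow> bool" where
  "is_db \<tau> D I \<longleftrightarrow>
     (\<forall>S. case \<tau> S of None \<Rightarrow> I S = {} | Some n \<Rightarrow> I S \<subseteq> tuples D n)"


section \<open>First-order formulas\<close>

datatype 'r fo =
    Top
  | Bot
  | Rel 'r "nat list"
  | Eq nat nat
  | Neg "'r fo"
  | Conj "'r fo" "'r fo"
  | Disj "'r fo" "'r fo"
  | Ex nat "'r fo"
  | All nat "'r fo"

primrec fv :: "'r fo \<Rightarrow> nat set" where
  "fv Top = {}"
| "fv Bot = {}"
| "fv (Rel S zs) = set zs"
| "fv (Eq x y) = {x, y}"
| "fv (Neg f) = fv f"
| "fv (Conj f g) = fv f \<union> fv g"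
| "fv (Disj f g) = fv f \<union> fv g"
| "fv (Ex x f) = fv f - {x}"
| "fv (All x f) = fv f - {x}"

primrec over_schema :: "'r schema \<Rightarrow> 'r fo \<Rightarrow> bool" where
  "over_schema \<tau> Top = True"
| "over_schema \<tau> Bot = True"
| "over_schema \<tau> (Rel S zs) = (\<tau> S = Some (length zs))"
| "over_schema \<tau> (Eq x y) = True"
| "over_schema \<tau> (Neg f) = over_schema \<tau> f"
| "over_schema \<tau> (Conj f g) = (over_schema \<tau> f \<and> over_schema \<tau> g)"
| "over_schema \<tau> (Disj f g) = (over_schema \<tau> f \<and> over_schema \<tau> g)"
| "over_schema \<tau> (Ex x f) = over_schema \<tau> f"
| "over_schema \<tau> (All x f) = over_schema \<tau> f"

primrec quantifier_free :: "'r fo \<Rightarrow> bool" where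
  "quantifier_free Top = True"
| "quantifier_free Bot = True"
| "quantifier_free (Rel S zs) = True"
| "quantifier_free (Eq x y) = True"
| "quantifier_free (Neg f) = quantifier_free f"
| "quantifier_free (Conj f g) = (quantifier_free f \<and> quantifier_free g)"
| "quantifier_free (Disj f g) = (quantifier_free f \<and> quantifier_free g)"
| "quantifier_free (Ex x f) = False"
| "quantifier_free (All x f) = False"

text \<open>Negation is permitted only in front of an equality between variables.\<close>

fun semi_positive :: "'r fo \<Rightarrow> bool" where
  "semi_positive Top = True"
| "semi_positive Bot = True"
| "semi_positive (Rel S zs) = True"
| "semi_positive (Eq x y) = True"
| "semi_positive (Neg (Eq x y)) = True"
| "semi_positive (Neg f) = False"
| "semi_positive (Conj f g) = (semi_positive f \<and> semi_positive g)"
| "semi_positive (Disj f g) = (semi_positive f \<and> semi_positive g)"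
| "semi_positive (Ex x f) = semi_positive f"
| "semi_positive (All x f) = semi_positive f"

primrec sat :: "'a set \<Rightarrow> ('r, 'a) db \<Rightarrow> (nat \<Rightarrow> 'a) \<Rightarrow> 'r fo \<Rightarrow> bool" where
  "sat D I \<sigma> Top = True"
| "sat D I \<sigma> Bot = False"
| "sat D I \<sigma> (Rel S zs) = (map \<sigma> zs \<in> I S)"
| "sat D I \<sigma> (Eq x y) = (\<sigma> x = \<sigma> y)"
| "sat D I \<sigma> (Neg f) = (\<not> sat D I \<sigma> f)"
| "sat D I \<sigma> (Conj f g) = (sat D I \<sigma> f \<and> sat D I \<sigma> g)"
| "sat D I \<sigma> (Disj f g) = (sat D I \<sigma> f \<or> sat D I \<sigma> g)"
| "sat D I \<sigma> (Ex x f) = (\<exists>d\<in>D. sat D I (\<sigma>(x := d)) f)"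
| "sat D I \<sigma> (All x f) = (\<forall>d\<in>D. sat D I (\<sigma>(x := d)) f)"

text \<open>
  Free variables are positional: in a formula with a tuple of \<open>n\<close> distinguished free
  variables, these are the variables \<open>0, \<dots>, n - 1\<close>, and a tuple \<open>t\<close> of
  length \<open>n\<close> is assigned to them by \<open>(!) t\<close>. The value of \<open>(!) t\<close> beyond
  the length of \<open>t\<close> is irrelevant since free variables are required to be below \<open>n\<close>.
\<close>

definition answers :: "'r fo \<Rightarrow> nat \<Rightarrow> ('r, 'a) query" where
  "answers f n D I = {b \<in> tuples D n. sat D I ((!) b) f}"

text \<open>
  The formula is \<open>\<exists>xs. g\<close> with \<open>k\<close> quantifiers, where \<open>g\<close> has
  its free variables among the quantified variables \<open>xs\<close> and the \<open>l\<close> free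
  variables \<open>0, \<dots>, l - 1\<close> of the query.
\<close>

definition semi_positive_existential :: "nat \<Rightarrow> nat \<Rightarrow> 'r fo \<Rightarrow> bool" where
  "semi_positive_existential l k f \<longleftrightarrow>
     (\<exists>xs g. f = foldr Ex xs g \<and> length xs = k \<and> distinct xs \<and> set xs \<inter> {..<l} = {} \<and>
       quantifier_free g \<and> semi_positive g \<and> fv g \<subseteq> set xs \<union> {..<l})"

definition semi_positive_existential_query ::
    "'r schema \<Rightarrow> nat \<Rightarrow> nat \<Rightarrow> ('r, 'a) query \<Rightarrow> bool" where
  "semi_positive_existential_query \<tau> l k q \<longleftrightarrow>
     (\<exists>f. semi_positive_existential l k f \<and> over_schema \<tau> f \<and>
       (\<forall>D I. finite D \<and> is_db \<tau> D I \<longrightarrow> q D I = answers f l D I))"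


section \<open>Dynamic programs\<close>

datatype 'r op = Ins (op_sym: 'r) | Del (op_sym: 'r)

type_synonym ('r, 'a) modification = "'r op \<times> 'a list"

definition is_modification :: "'r schema \<Rightarrow> 'a set \<Rightarrow> ('r, 'a) modification \<Rightarrow> bool" where
  "is_modification \<tau> D m \<longleftrightarrow>
     (\<exists>n. \<tau> (op_sym (fst m)) = Some n \<and> snd m \<in> tuples D n)"

fun modify :: "('r, 'a) modification \<Rightarrow> ('r, 'a) db \<Rightarrow> ('r, 'a) db" where
  "modify (Ins S, a) I = I(S := insert a (I S))"
| "modify (Del S, a) I = I(S := I S - {a})"

text \<open>
  Auxiliary symbols are drawn from \<^typ>\<open>nat\<close>, which is no restriction because the
  auxiliary schema is finite; input and auxiliary symbols are kept apart by the sum type.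
  The update formula \<open>update P R \<delta>\<close> has the free variables
  \<open>0, \<dots>, n + m - 1\<close>, the first \<open>n\<close> for the modified tuple and the other
  \<open>m\<close> for the tuple of \<open>R\<close>, where \<open>n\<close> is the arity of the modified
  input symbol and \<open>m\<close> the arity of \<open>R\<close>.
\<close>

record ('r, 'a) dyn_program =
  aux :: "nat schema"
  update :: "nat \<Rightarrow> 'r op \<Rightarrow> ('r + nat) fo"
  init :: "'a set \<Rightarrow> ('r, 'a) db \<Rightarrow> (nat, 'a) db"
  query_sym :: nat

definition is_dyn_program :: "'r schema \<Rightarrow> ('r, 'a) dyn_program \<Rightarrow> bool" where
  "is_dyn_program \<tau> P \<longleftrightarrow>
     finite (dom (aux P)) \<and>
     query_sym P \<in> dom (aux P) \<and>
     (\<forall>R m \<delta> n. aux P R = Some m \<and> \<tau> (op_sym \<delta>) = Some n \<longrightarrow>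
        over_schema (case_sum \<tau> (aux P)) (update P R \<delta>) \<and> fv (update P R \<delta>) \<subseteq> {..<n + m}) \<and>
     (\<forall>D I. finite D \<and> is_db \<tau> D I \<longrightarrow> is_db (aux P) D (init P D I))"

definition step ::
    "('r, 'a) dyn_program \<Rightarrow> 'a set \<Rightarrow> ('r, 'a) modification \<Rightarrow>
     ('r, 'a) db \<times> (nat, 'a) db \<Rightarrow> ('r, 'a) db \<times> (nat, 'a) db" where
  "step P D = (\<lambda>(\<delta>, a) (I, A).
     (modify (\<delta>, a) I,
      \<lambda>R. case aux P R of
            None \<Rightarrow> {}
          | Some m \<Rightarrow> {b \<in> tuples D m. sat D (case_sum I A) ((!) (a @ b)) (update P R \<delta>)}))"

definition maintains_for ::
    "('r op \<Rightarrow> bool) \<Rightarrow> 'r schema \<Rightarrow> ('r, 'a) dyn_program \<Rightarrow> ('r, 'a) query \<Rightarrow> bool" where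
  "maintains_for allowed \<tau> P q \<longleftrightarrow>
     (\<forall>D I \<alpha>. finite D \<and> is_db \<tau> D I \<and>
        (\<forall>m\<in>set \<alpha>. is_modification \<tau> D m \<and> allowed (fst m)) \<longrightarrow>
        snd (fold (step P D) \<alpha> (I, init P D I)) (query_sym P) = q D (fold modify \<alpha> I))"

abbreviation maintains :: "'r schema \<Rightarrow> ('r, 'a) dyn_program \<Rightarrow> ('r, 'a) query \<Rightarrow> bool" where
  "maintains \<equiv> maintains_for (\<lambda>_. True)"

abbreviation maintains_under_insertions ::
    "'r schema \<Rightarrow> ('r, 'a) dyn_program \<Rightarrow> ('r, 'a) query \<Rightarrow> bool" where
  "maintains_under_insertions \<equiv> maintains_for is_Ins"

definition quantifier_free_program :: "'r schema \<Rightarrow> ('r, 'a) dyn_program \<Rightarrow> bool" where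
  "quantifier_free_program \<tau> P \<longleftrightarrow>
     (\<forall>R \<delta>. R \<in> dom (aux P) \<and> op_sym \<delta> \<in> dom \<tau> \<longrightarrow> quantifier_free (update P R \<delta>))"

definition ary_program :: "nat \<Rightarrow> ('r, 'a) dyn_program \<Rightarrow> bool" where
  "ary_program m P \<longleftrightarrow> (\<forall>n\<in>ran (aux P). n \<le> m)"

text \<open>The \<open>l\<close>-ary query \<open>q\<close> is maintainable under insertions in \<open>m\<close>-ary DynProp.\<close>

definition in_DynProp_under_insertions ::
    "nat \<Rightarrow> 'r schema \<Rightarrow> nat \<Rightarrow> ('r, 'a) query \<Rightarrow> bool" where
  "in_DynProp_under_insertions m \<tau> l q \<longleftrightarrow>
     (\<exists>P. is_dyn_program \<tau> P \<and> quantifier_free_program \<tau> P \<and> ary_program m P \<and>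
       aux P (query_sym P) = Some l \<and> maintains_under_insertions \<tau> P q)"

text \<open>
  The query symbol is itself an auxiliary symbol, so \<open>m\<close> is never below the arity of
  the query. For a query with \<open>k\<close> quantifiers the bound \<open>l + k - 1\<close> is therefore
  attainable only if \<open>k \<ge> 1\<close>; with \<open>k = 0\<close> the least possible value is \<open>l\<close>.
\<close>

lemma in_DynProp_under_insertions_arity:
  "in_DynProp_under_insertions m \<tau> l q \<Longrightarrow> l \<le> m"
  unfolding in_DynProp_under_insertions_def ary_program_def by (blast intro: ranI)

end

theory Submission imports Defs begin

text \<open>
  Let \<open>\<exists>xs. g\<close> be the defining formula. For every set \<open>X\<close> of quantified variables and every
  set \<open>T\<close> of atoms of \<open>g\<close>, store the relation defined by \<open>\<exists>X. g\<^sub>T\<close>, where \<open>g\<^sub>T\<close> is \<open>g\<close> with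
  the atoms of \<open>T\<close> replaced by truth and where the variables outside \<open>X\<close> are free. After the
  insertion of \<open>a\<close> into \<open>S\<close>, either a witness for \<open>\<exists>X. g\<^sub>T\<close> takes a value of \<open>a\<close> at some
  \<open>x \<in> X\<close>, and then \<open>\<exists>(X - {x}). g\<^sub>T\<close> holds after the insertion with \<open>x\<close> set to that value; or no
  value of the witness on \<open>X\<close> occurs in \<open>a\<close>, and then the only atoms that became true are
  atoms \<open>S(zs)\<close> without variables from \<open>X\<close>, which may be moved to \<open>T\<close> since \<open>zs = a\<close> is a quantifier-free
  condition. Unfolding the first alternative down to \<open>X = {}\<close>, where \<open>g\<^sub>T\<close> is evaluated directly,
  gives quantifier-free update formulas that read only relations with \<open>X \<noteq> {}\<close>. These have
  arity at most \<open>l + k - 1\<close>.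
\<close>

section \<open>Quantifier-free formulas\<close>

text \<open>Equalities are left out because only relation atoms can change their truth value under
  an insertion.\<close>

primrec atoms :: "'r fo \<Rightarrow> ('r \<times> nat list) set" where
  "atoms Top = {}"
| "atoms Bot = {}"
| "atoms (Rel S zs) = {(S, zs)}"
| "atoms (Eq x y) = {}"
| "atoms (Neg f) = atoms f"
| "atoms (Conj f g) = atoms f \<union> atoms g"
| "atoms (Disj f g) = atoms f \<union> atoms g"
| "atoms (Ex x f) = atoms f"
| "atoms (All x f) = atoms f"

lemma finite_atoms [simp]: "finite (atoms f)"
  by (induction f) auto

lemma over_schema_atoms: "over_schema \<tau> f \<Longrightarrow> (R, zs) \<in> atoms f \<Longrightarrow> \<tau> R = Some (length zs)"
  by (induction f) auto

lemma atoms_fv: "quantifier_free f \<Longrightarrow> (R, zs) \<in> atoms f \<Longrightarrow> set zs \<subseteq> fv f"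
  by (induction f) auto

text \<open>The equations for quantifiers are junk.\<close>

primrec holds :: "('r \<Rightarrow> nat list \<Rightarrow> bool) \<Rightarrow> (nat \<Rightarrow> 'a) \<Rightarrow> 'r fo \<Rightarrow> bool" where
  "holds V \<sigma> Top = True"
| "holds V \<sigma> Bot = False"
| "holds V \<sigma> (Rel S zs) = V S zs"
| "holds V \<sigma> (Eq x y) = (\<sigma> x = \<sigma> y)"
| "holds V \<sigma> (Neg f) = (\<not> holds V \<sigma> f)"
| "holds V \<sigma> (Conj f g) = (holds V \<sigma> f \<and> holds V \<sigma> g)"
| "holds V \<sigma> (Disj f g) = (holds V \<sigma> f \<or> holds V \<sigma> g)"
| "holds V \<sigma> (Ex x f) = False"
| "holds V \<sigma> (All x f) = False"

text \<open>The point of \<open>holds\<close> is that \<open>V\<close> values atoms individually and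
  not through tuples, so that the atoms of \<open>T\<close> can be declared true.\<close>

lemma sat_iff_holds:
  "quantifier_free f \<Longrightarrow> sat D I \<sigma> f \<longleftrightarrow> holds (\<lambda>R zs. map \<sigma> zs \<in> I R) \<sigma> f"
  by (induction f) auto

text \<open>Relation atoms occur only positively, and equalities see the same values on both sides.
  This is where semi-positivity enters.\<close>

lemma holds_mono:
  assumes "quantifier_free f" "semi_positive f" "holds V \<sigma> f"
    and "\<And>R zs. (R, zs) \<in> atoms f \<Longrightarrow> V R zs \<Longrightarrow> V' R zs"
    and "\<And>v. v \<in> fv f \<Longrightarrow> \<sigma> v = \<sigma>' v"
  shows "holds V' \<sigma>' f"
  using assms by (induction f rule: semi_positive.induct) auto

lemma sat_foldr_Ex:
  "sat D I \<sigma> (foldr Ex xs f) \<longleftrightarrow>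
     (\<exists>\<sigma>'. (\<forall>v. v \<notin> set xs \<longrightarrow> \<sigma>' v = \<sigma> v) \<and> \<sigma>' ` set xs \<subseteq> D \<and> sat D I \<sigma>' f)"
proof (induction xs arbitrary: \<sigma>)
  case Nil
  then show ?case by (auto simp flip: fun_eq_iff)
next
  case (Cons x xs)
  have "(\<exists>d\<in>D. \<exists>\<sigma>'. (\<forall>v. v \<notin> set xs \<longrightarrow> \<sigma>' v = (\<sigma>(x := d)) v) \<and> \<sigma>' ` set xs \<subseteq> D \<and> sat D I \<sigma>' f)
    \<longleftrightarrow> (\<exists>\<sigma>'. (\<forall>v. v \<notin> set (x # xs) \<longrightarrow> \<sigma>' v = \<sigma> v) \<and> \<sigma>' ` set (x # xs) \<subseteq> D \<and> sat D I \<sigma>' f)"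
    (is "?L \<longleftrightarrow> ?R")
  proof
    assume ?L
    then obtain d \<sigma>' where s: "d \<in> D" "\<forall>v. v \<notin> set xs \<longrightarrow> \<sigma>' v = (\<sigma>(x := d)) v"
      "\<sigma>' ` set xs \<subseteq> D" "sat D I \<sigma>' f" by blast
    \<comment> \<open>If \<open>x\<close> recurs in \<open>xs\<close>, then
      \<open>\<sigma>' x\<close> may differ from \<open>d\<close>, but it lies in \<open>D\<close>
      by the condition on \<open>xs\<close>.\<close>
    have "\<sigma>' x \<in> D" using s by (cases "x \<in> set xs") auto
    with s show ?R by (intro exI[of _ \<sigma>']) auto
  next
    assume ?R
    then obtain \<sigma>' where "\<forall>v. v \<notin> set (x # xs) \<longrightarrow> \<sigma>' v = \<sigma> v" "\<sigma>' ` set (x # xs) \<subseteq> D" "sat D I \<sigma>' f"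
      by blast
    then show ?L by (intro bexI[of _ "\<sigma>' x"] exI[of _ \<sigma>']) auto
  qed
  with Cons show ?case by simp
qed

section \<open>Conditions expressible without quantifiers\<close>

text \<open>\<open>C\<close> restricts the states in which the formula must be correct; it will say
  that the auxiliary relations have their intended contents. One formula has to serve all domains
  and databases.\<close>

definition expressible ::
    "'r schema \<Rightarrow> nat \<Rightarrow> ('a set \<Rightarrow> ('r, 'a) db \<Rightarrow> (nat \<Rightarrow> 'a) \<Rightarrow> bool) \<Rightarrow>
     ('a set \<Rightarrow> ('r, 'a) db \<Rightarrow> (nat \<Rightarrow> 'a) \<Rightarrow> bool) \<Rightarrow> bool" where
  "expressible \<tau> N C P \<longleftrightarrow>
     (\<exists>f. quantifier_free f \<and> over_schema \<tau> f \<and> fv f \<subseteq> {..<N} \<and>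
       (\<forall>D I \<sigma>. C D I \<sigma> \<longrightarrow> (sat D I \<sigma> f \<longleftrightarrow> P D I \<sigma>)))"

lemma expressibleI:
  assumes "quantifier_free f" "over_schema \<tau> f" "fv f \<subseteq> {..<N}"
    and "\<And>D I \<sigma>. C D I \<sigma> \<Longrightarrow> sat D I \<sigma> f \<longleftrightarrow> P D I \<sigma>"
  shows "expressible \<tau> N C P"
  using assms unfolding expressible_def by blast

lemma expressible_cong:
  assumes "expressible \<tau> N C P" "\<And>D I \<sigma>. C D I \<sigma> \<Longrightarrow> P D I \<sigma> \<longleftrightarrow> P' D I \<sigma>"
  shows "expressible \<tau> N C P'"
  using assms unfolding expressible_def by meson

lemma expressible_const: "expressible \<tau> N C (\<lambda>D I \<sigma>. b)"
  by (cases b) (auto intro: expressibleI[where f = Top] expressibleI[where f = Bot])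

lemma expressible_eq: "x < N \<Longrightarrow> y < N \<Longrightarrow> expressible \<tau> N C (\<lambda>D I \<sigma>. \<sigma> x = \<sigma> y)"
  by (rule expressibleI[where f = "Eq x y"]) auto

lemma expressible_rel:
  "\<tau> R = Some (length zs) \<Longrightarrow> set zs \<subseteq> {..<N} \<Longrightarrow> expressible \<tau> N C (\<lambda>D I \<sigma>. map \<sigma> zs \<in> I R)"
  by (rule expressibleI[where f = "Rel R zs"]) auto

lemma expressible_not:
  "expressible \<tau> N C P \<Longrightarrow> expressible \<tau> N C (\<lambda>D I \<sigma>. \<not> P D I \<sigma>)"
  unfolding expressible_def by (metis fv.simps(5) over_schema.simps(5) quantifier_free.simps(5) sat.simps(5))

lemma expressible_conj:
  assumes "expressible \<tau> N C P" "expressible \<tau> N C Q"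
  shows "expressible \<tau> N C (\<lambda>D I \<sigma>. P D I \<sigma> \<and> Q D I \<sigma>)"
proof -
  obtain f where "quantifier_free f" "over_schema \<tau> f" "fv f \<subseteq> {..<N}"
    "\<forall>D I \<sigma>. C D I \<sigma> \<longrightarrow> (sat D I \<sigma> f \<longleftrightarrow> P D I \<sigma>)"
    using assms(1) unfolding expressible_def by blast
  moreover obtain h where "quantifier_free h" "over_schema \<tau> h" "fv h \<subseteq> {..<N}"
    "\<forall>D I \<sigma>. C D I \<sigma> \<longrightarrow> (sat D I \<sigma> h \<longleftrightarrow> Q D I \<sigma>)"
    using assms(2) unfolding expressible_def by blast
  ultimately show ?thesis by (intro expressibleI[where f = "Conj f h"]) auto
qed

lemma expressible_disj:
  assumes "expressible \<tau> N C P" "expressible \<tau> N C Q"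
  shows "expressible \<tau> N C (\<lambda>D I \<sigma>. P D I \<sigma> \<or> Q D I \<sigma>)"
  using expressible_not[OF expressible_conj[OF expressible_not expressible_not], OF assms] by simp

lemma expressible_ball:
  assumes "finite K" "\<And>i. i \<in> K \<Longrightarrow> expressible \<tau> N C (P i)"
  shows "expressible \<tau> N C (\<lambda>D I \<sigma>. \<forall>i\<in>K. P i D I \<sigma>)"
  using assms by (induction K rule: finite_induct) (simp_all add: expressible_const expressible_conj)

lemma expressible_bex:
  assumes "finite K" "\<And>i. i \<in> K \<Longrightarrow> expressible \<tau> N C (P i)"
  shows "expressible \<tau> N C (\<lambda>D I \<sigma>. \<exists>i\<in>K. P i D I \<sigma>)"
  using assms by (induction K rule: finite_induct) (simp_all add: expressible_const expressible_disj)

lemma expressible_map_eq: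
  assumes "set zs \<subseteq> {..<N}" "set ws \<subseteq> {..<N}"
  shows "expressible \<tau> N C (\<lambda>D I \<sigma>. map \<sigma> zs = map \<sigma> ws)"
proof (cases "length zs = length ws")
  case True
  have "expressible \<tau> N C (\<lambda>D I \<sigma>. \<forall>i\<in>{..<length zs}. \<sigma> (zs ! i) = \<sigma> (ws ! i))"
    using assms True by (intro expressible_ball expressible_eq) (auto simp: subset_iff)
  then show ?thesis
    by (rule expressible_cong) (auto simp: True list_eq_iff_nth_eq)
next
  case False
  show ?thesis
    by (rule expressible_cong[OF expressible_const[of _ _ _ False]])
      (use False in \<open>auto dest: map_eq_imp_length_eq\<close>)
qed

text \<open>Each relation atom of \<open>f\<close> is replaced by a formula for its value under
  \<open>V\<close>, and equalities are renamed by \<open>\<rho>\<close>.\<close>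

lemma expressible_holds:
  assumes "\<And>R zs. (R, zs) \<in> atoms f \<Longrightarrow> expressible \<tau> N C (\<lambda>D I \<sigma>. V D I \<sigma> R zs)"
    and "\<rho> ` fv f \<subseteq> {..<N}" "quantifier_free f"
  shows "expressible \<tau> N C (\<lambda>D I \<sigma>. holds (V D I \<sigma>) (\<sigma> \<circ> \<rho>) f)"
  using assms
  by (induction f)
    (auto intro!: expressible_const expressible_eq expressible_not expressible_conj expressible_disj)

section \<open>The auxiliary relations\<close>

text \<open>Auxiliary symbols are natural numbers, so \<open>code\<close> numbers the pairs
  \<open>(X, T)\<close> that index the auxiliary relations.\<close>

locale existential_query =
  fixes \<tau> :: "'r schema" and l :: nat and xs :: "nat list" and g :: "'r fo"
    and code :: "nat set \<times> ('r \<times> nat list) set \<Rightarrow> nat"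
  assumes distinct_xs: "distinct xs" and disjoint_xs: "set xs \<inter> {..<l} = {}"
    and qf: "quantifier_free g" and pos: "semi_positive g"
    and fv_g: "fv g \<subseteq> set xs \<union> {..<l}" and schema_g: "over_schema \<tau> g"
    and inj_code: "inj_on code (Pow (set xs) \<times> Pow (atoms g))"
begin

text \<open>The columns of a relation stored for \<open>X\<close>; for \<open>X\<close> within
  \<open>xs\<close> its arity is \<open>l + k - card X\<close>.\<close>

definition vars :: "nat set \<Rightarrow> nat list" where
  "vars X = [0..<l] @ filter (\<lambda>x. x \<notin> X) xs"

text \<open>The truth of \<open>\<exists>X. g\<^sub>T\<close> under \<open>\<sigma>\<close>.
  Agreement is demanded on \<open>fv g - X\<close> only, so a witness is unconstrained on variables
  outside \<open>fv g\<close> and \<open>X\<close>.\<close>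

definition wit :: "'a set \<Rightarrow> ('r, 'a) db \<Rightarrow> nat set \<Rightarrow> ('r \<times> nat list) set \<Rightarrow> (nat \<Rightarrow> 'a) \<Rightarrow> bool" where
  "wit D I X T \<sigma> \<longleftrightarrow>
     (\<exists>\<sigma>'. (\<forall>v\<in>fv g - X. \<sigma>' v = \<sigma> v) \<and> \<sigma>' ` X \<subseteq> D \<and>
       holds (\<lambda>R zs. (R, zs) \<in> T \<or> map \<sigma>' zs \<in> I R) \<sigma>' g)"

text \<open>The pairs with \<open>X = {}\<close> are left out unless \<open>k = 0\<close>: their relations would have arity \<open>l + k\<close>.\<close>

definition keys :: "(nat set \<times> ('r \<times> nat list) set) set" where
  "keys = {(X, T). X \<subseteq> set xs \<and> T \<subseteq> atoms g \<and> (X \<noteq> {} \<or> xs = [])}"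

definition decode :: "nat \<Rightarrow> nat set \<times> ('r \<times> nat list) set" where
  "decode = inv_into keys code"

definition schema :: "nat schema" where
  "schema R = (if R \<in> code ` keys then Some (length (vars (fst (decode R)))) else None)"

text \<open>The intended contents of all auxiliary relations, serving both as initialisation and as
  invariant.\<close>

definition aux_db :: "'a set \<Rightarrow> ('r, 'a) db \<Rightarrow> (nat, 'a) db" where
  "aux_db D I R = (if R \<in> code ` keys
     then (case decode R of (X, T) \<Rightarrow> {map \<sigma> (vars X) |\<sigma>. \<sigma> ` set (vars X) \<subseteq> D \<and> wit D I X T \<sigma>})
     else {})"

lemma finite_keys: "finite keys"
  by (rule finite_subset[of _ "Pow (set xs) \<times> Pow (atoms g)"]) (auto simp: keys_def)

lemma decode_code: "p \<in> keys \<Longrightarrow> decode (code p) = p"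
  unfolding decode_def
  by (rule inv_into_f_f[OF inj_on_subset[OF inj_code]]) (auto simp: keys_def)

lemma distinct_vars: "distinct (vars X)"
  using distinct_xs disjoint_xs by (auto simp: vars_def)

lemma set_vars: "set (vars X) = {..<l} \<union> (set xs - X)"
  by (auto simp: vars_def)

lemma schema_code: "(X, T) \<in> keys \<Longrightarrow> schema (code (X, T)) = Some (length (vars X))"
  by (simp add: schema_def decode_code)

lemma wit_cong: "(\<And>v. v \<in> set (vars X) \<Longrightarrow> \<sigma> v = \<sigma>' v) \<Longrightarrow> wit D I X T \<sigma> \<longleftrightarrow> wit D I X T \<sigma>'"
  using fv_g unfolding wit_def set_vars by (intro ex_cong1 conj_cong ball_cong) auto

text \<open>Many valuations yield the same tuple, but they agree on \<open>vars X\<close>, and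
  \<open>wit\<close> depends on nothing else.\<close>

lemma map_vars_in_aux_db:
  assumes "(X, T) \<in> keys" "\<sigma> ` set (vars X) \<subseteq> D"
  shows "map \<sigma> (vars X) \<in> aux_db D I (code (X, T)) \<longleftrightarrow> wit D I X T \<sigma>"
proof -
  have "map \<sigma> (vars X) \<in> aux_db D I (code (X, T)) \<longleftrightarrow>
    (\<exists>\<sigma>'. map \<sigma> (vars X) = map \<sigma>' (vars X) \<and> \<sigma>' ` set (vars X) \<subseteq> D \<and> wit D I X T \<sigma>')"
    using assms(1) by (simp add: aux_db_def decode_code)
  also have "\<dots> \<longleftrightarrow> wit D I X T \<sigma>"
  proof (intro iffI; (elim exE conjE)?)
    fix \<sigma>' assume "map \<sigma> (vars X) = map \<sigma>' (vars X)" and w: "wit D I X T \<sigma>'"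
    then have "\<sigma>' v = \<sigma> v" if "v \<in> set (vars X)" for v using that by simp
    from wit_cong[OF this] w show "wit D I X T \<sigma>" by simp
  next
    assume "wit D I X T \<sigma>"
    then show "\<exists>\<sigma>'. map \<sigma> (vars X) = map \<sigma>' (vars X) \<and> \<sigma>' ` set (vars X) \<subseteq> D \<and> wit D I X T \<sigma>'"
      using assms(2) by blast
  qed
  finally show ?thesis .
qed

lemma aux_db_subset: "aux_db D I R \<subseteq> (case schema R of None \<Rightarrow> {} | Some m \<Rightarrow> tuples D m)"
  by (auto simp: aux_db_def schema_def tuples_def split: prod.splits)

section \<open>Effect of an insertion on the stored conditions\<close>

lemma wit_empty:
  "wit D I {} T \<sigma> \<longleftrightarrow> holds (\<lambda>R zs. (R, zs) \<in> T \<or> map \<sigma> zs \<in> I R) \<sigma> g"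
proof
  assume "wit D I {} T \<sigma>"
  then obtain \<sigma>' where s: "\<forall>v\<in>fv g. \<sigma>' v = \<sigma> v"
    and h: "holds (\<lambda>R zs. (R, zs) \<in> T \<or> map \<sigma>' zs \<in> I R) \<sigma>' g"
    unfolding wit_def by auto
  have "map \<sigma>' zs = map \<sigma> zs" if "(R, zs) \<in> atoms g" for R zs
    using atoms_fv[OF qf that] s by auto
  with s show "holds (\<lambda>R zs. (R, zs) \<in> T \<or> map \<sigma> zs \<in> I R) \<sigma> g"
    by (intro holds_mono[OF qf pos h]) metis+
qed (auto simp: wit_def)

text \<open>The first alternative refers to the new database but to a smaller \<open>X\<close>, so
  it can be unfolded again; the second refers to the old database only, so it can be read off a
  stored relation.\<close>

lemma wit_insert:
  fixes I :: "('r, 'a) db"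
  defines "I' \<equiv> \<lambda>S a. I(S := insert a (I S))"
  assumes a: "set a \<subseteq> D"
  shows "wit D (I' S a) X T \<sigma> \<longleftrightarrow>
    (\<exists>x\<in>X. \<exists>j\<in>{..<length a}. wit D (I' S a) (X - {x}) T (\<sigma>(x := a ! j))) \<or>
    (\<exists>Z\<in>Pow {zs. (S, zs) \<in> atoms g \<and> set zs \<inter> X = {}}.
       (\<forall>zs\<in>Z. map \<sigma> zs = a) \<and> wit D I X (T \<union> Pair S ` Z) \<sigma>)"
    (is "_ \<longleftrightarrow> ?A \<or> ?B")
proof
  assume "wit D (I' S a) X T \<sigma>"
  then obtain \<sigma>' where s: "\<forall>v\<in>fv g - X. \<sigma>' v = \<sigma> v" "\<sigma>' ` X \<subseteq> D"
    and h: "holds (\<lambda>R zs. (R, zs) \<in> T \<or> map \<sigma>' zs \<in> I' S a R) \<sigma>' g"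
    unfolding wit_def by auto
  show "?A \<or> ?B"
  proof (cases "\<sigma>' ` X \<inter> set a = {}")
    case False
    then obtain x where "x \<in> X" "\<sigma>' x \<in> set a" by blast
    then obtain j where x: "x \<in> X" "j < length a" "a ! j = \<sigma>' x" by (auto simp: in_set_conv_nth)
    have "\<forall>v\<in>fv g - (X - {x}). \<sigma>' v = (\<sigma>(x := a ! j)) v" "\<sigma>' ` (X - {x}) \<subseteq> D"
      using s x(3) by auto
    then have "wit D (I' S a) (X - {x}) T (\<sigma>(x := a ! j))"
      unfolding wit_def using h by blast
    then have ?A using x(1,2) by (intro bexI[of _ x] bexI[of _ j]) simp_all
    then show ?thesis ..
  next
    case True
    \<comment> \<open>All atoms that the insertion can have made true under \<open>\<sigma>'\<close>
      in this case.\<close>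
    define Z where "Z = {zs. (S, zs) \<in> atoms g \<and> set zs \<inter> X = {} \<and> map \<sigma> zs = a}"
    have "(R, zs) \<in> T \<union> Pair S ` Z \<or> map \<sigma>' zs \<in> I R"
      if at: "(R, zs) \<in> atoms g" and "(R, zs) \<in> T \<or> map \<sigma>' zs \<in> I' S a R" for R zs
    proof (cases "R = S \<and> map \<sigma>' zs = a")
      case new: True
      \<comment> \<open>A variable of \<open>X\<close> in \<open>zs\<close> would put a value of
        \<open>\<sigma>'\<close> on \<open>X\<close> into \<open>a\<close>, which this case
        excludes.\<close>
      then have X: "set zs \<inter> X = {}" using True by auto
      have "\<sigma> v = \<sigma>' v" if "v \<in> set zs" for v
        using that X s(1) atoms_fv[OF qf at] by (metis DiffI disjoint_iff subsetD)
      then have "map \<sigma> zs = a" using new by auto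
      with X new at show ?thesis by (auto simp: Z_def)
    next
      case False
      with that show ?thesis by (auto simp: I'_def split: if_splits)
    qed
    then have "holds (\<lambda>R zs. (R, zs) \<in> T \<union> Pair S ` Z \<or> map \<sigma>' zs \<in> I R) \<sigma>' g"
      by (intro holds_mono[OF qf pos h]) auto
    then have "wit D I X (T \<union> Pair S ` Z) \<sigma>"
      unfolding wit_def using s by blast
    then have ?B by (intro bexI[of _ Z]) (auto simp: Z_def)
    then show ?thesis ..
  qed
next
  assume "?A \<or> ?B"
  then show "wit D (I' S a) X T \<sigma>"
  proof
    assume ?A
    then obtain x j \<sigma>' where x: "x \<in> X" "j < length a"
      and s: "\<forall>v\<in>fv g - (X - {x}). \<sigma>' v = (\<sigma>(x := a ! j)) v" "\<sigma>' ` (X - {x}) \<subseteq> D"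
      and h: "holds (\<lambda>R zs. (R, zs) \<in> T \<or> map \<sigma>' zs \<in> I' S a R) \<sigma>' g"
      unfolding wit_def by blast
    \<comment> \<open>If \<open>x\<close> is not free in \<open>g\<close>, then
      \<open>\<sigma>' x\<close> is arbitrary and may lie outside \<open>D\<close>; it is reset to
      an entry of \<open>a\<close>.\<close>
    define \<sigma>'' where "\<sigma>'' = \<sigma>'(x := a ! j)"
    have eq: "\<sigma>' v = \<sigma>'' v" if "v \<in> fv g" for v
      using s that by (auto simp: \<sigma>''_def)
    have "map \<sigma>' zs = map \<sigma>'' zs" if "(R, zs) \<in> atoms g" for R zs
      using atoms_fv[OF qf that] eq by auto
    with eq have "holds (\<lambda>R zs. (R, zs) \<in> T \<or> map \<sigma>'' zs \<in> I' S a R) \<sigma>'' g"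
      by (intro holds_mono[OF qf pos h]) metis+
    moreover have "\<sigma>'' ` X \<subseteq> D" "\<forall>v\<in>fv g - X. \<sigma>'' v = \<sigma> v"
      using s x a by (auto simp: \<sigma>''_def)
    ultimately show ?thesis unfolding wit_def by blast
  next
    assume ?B
    then obtain Z where "Z \<in> Pow {zs. (S, zs) \<in> atoms g \<and> set zs \<inter> X = {}}"
      and a_eq: "\<forall>zs\<in>Z. map \<sigma> zs = a" and w: "wit D I X (T \<union> Pair S ` Z) \<sigma>"
      by (elim bexE conjE)
    then have Z: "(S, zs) \<in> atoms g" "set zs \<inter> X = {}" if "zs \<in> Z" for zs
      using that by blast+
    from w obtain \<sigma>' where s: "\<forall>v\<in>fv g - X. \<sigma>' v = \<sigma> v" "\<sigma>' ` X \<subseteq> D"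
      and h: "holds (\<lambda>R zs. (R, zs) \<in> T \<union> Pair S ` Z \<or> map \<sigma>' zs \<in> I R) \<sigma>' g"
      unfolding wit_def by (elim exE conjE)
    \<comment> \<open>Atoms in \<open>Z\<close> avoid \<open>X\<close>, so the witness gives them
      the tuple \<open>a\<close>: after the insertion they are true without being forced.\<close>
    have "map \<sigma>' zs = a" if "zs \<in> Z" for zs
    proof -
      have "\<sigma>' v = \<sigma> v" if "v \<in> set zs" for v
        using that s(1) Z[OF \<open>zs \<in> Z\<close>] atoms_fv[OF qf, of S zs] by (metis DiffI disjoint_iff subsetD)
      then have "map \<sigma>' zs = map \<sigma> zs" by simp
      with a_eq that show ?thesis by simp
    qed
    then have "holds (\<lambda>R zs. (R, zs) \<in> T \<or> map \<sigma>' zs \<in> I' S a R) \<sigma>' g"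
      by (intro holds_mono[OF qf pos h]) (auto simp: I'_def)
    with s show ?thesis unfolding wit_def by blast
  qed
qed

section \<open>The update formulas\<close>

text \<open>
  The map \<open>\<rho>\<close> sends the variables of \<open>g\<close> to those of the update formula, in which
  \<open>0, \<dots>, n - 1\<close> stand for the inserted tuple.
\<close>

lemma expressible_wit_insert:
  assumes S: "\<tau> S = Some n" and "n \<le> N"
    and "X \<subseteq> set xs" and T: "T \<subseteq> atoms g" and "\<rho> ` set (vars X) \<subseteq> {..<N}"
  shows "expressible (case_sum \<tau> schema) N
    (\<lambda>D J \<sigma>. \<sigma> ` {..<N} \<subseteq> D \<and> J \<circ> Inr = aux_db D (J \<circ> Inl))
    (\<lambda>D J \<sigma>. wit D ((J \<circ> Inl)(S := insert (map \<sigma> [0..<n]) (J (Inl S)))) X T (\<sigma> \<circ> \<rho>))"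
    (is "expressible _ _ ?C _")
proof -
  have "finite X" using \<open>X \<subseteq> set xs\<close> by (rule finite_subset) simp
  then show ?thesis using assms(3,5)
  \<comment> \<open>\<open>\<rho>\<close> must vary: each unfolding removes some \<open>x\<close>
    from \<open>X\<close> and sends it to a variable of the inserted tuple.\<close>
  proof (induction X arbitrary: \<rho> rule: finite_psubset_induct)
    case (psubset X)
    show ?case
    proof (cases "X = {}")
      case True
      have \<rho>: "\<rho> ` fv g \<subseteq> {..<N}" using psubset.prems(2) fv_g by (auto simp: set_vars True)
      \<comment> \<open>Base case: every variable of \<open>g\<close> now has a counterpart in the
        update formula, so each atom is tested directly against \<open>T\<close>, the old relation
        and the inserted tuple.\<close>
      have "expressible (case_sum \<tau> schema) N ?C (\<lambda>D J \<sigma>. (R, zs) \<in> T \<or>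
        map (\<sigma> \<circ> \<rho>) zs \<in> ((J \<circ> Inl)(S := insert (map \<sigma> [0..<n]) (J (Inl S)))) R)"
        if at: "(R, zs) \<in> atoms g" for R zs
      proof (rule expressible_cong)
        have z: "set (map \<rho> zs) \<subseteq> {..<N}" using atoms_fv[OF qf at] \<rho> by auto
        then show "expressible (case_sum \<tau> schema) N ?C (\<lambda>D J \<sigma>. (R, zs) \<in> T \<or>
          (map \<sigma> (map \<rho> zs) \<in> J (Inl R) \<or> R = S \<and> map \<sigma> (map \<rho> zs) = map \<sigma> [0..<n]))"
          using \<open>n \<le> N\<close> over_schema_atoms[OF schema_g at]
          by (intro expressible_disj expressible_conj expressible_const expressible_rel
              expressible_map_eq) auto
      qed auto
      then show ?thesis
        unfolding True wit_empty by (intro expressible_holds qf \<rho>)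
    next
      case False
      define B where "B = {zs. (S, zs) \<in> atoms g \<and> set zs \<inter> X = {}}"
      have "finite (Pair S ` B)" by (rule finite_subset[of _ "atoms g"]) (auto simp: B_def)
      then have "finite B" by (rule finite_imageD) (auto simp: inj_on_def)
      \<comment> \<open>Since \<open>X\<close> is nonempty, the relations needed here are among the
        stored ones.\<close>
      have key: "(X, T \<union> Pair S ` Z) \<in> keys" if "Z \<subseteq> B" for Z
        using that False psubset.prems(1) T by (auto simp: keys_def B_def)
      show ?thesis
      proof (rule expressible_cong)
        \<comment> \<open>All index sets are finite and independent of the state, so the quantifiers
          over them become finite disjunctions and conjunctions.\<close>
        show "expressible (case_sum \<tau> schema) N ?C (\<lambda>D J \<sigma>.
          (\<exists>x\<in>X. \<exists>j\<in>{..<n}. wit D ((J \<circ> Inl)(S := insert (map \<sigma> [0..<n]) (J (Inl S))))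
             (X - {x}) T (\<sigma> \<circ> \<rho>(x := j))) \<or>
          (\<exists>Z\<in>Pow B. (\<forall>zs\<in>Z. map \<sigma> (map \<rho> zs) = map \<sigma> [0..<n]) \<and>
             map \<sigma> (map \<rho> (vars X)) \<in> J (Inr (code (X, T \<union> Pair S ` Z)))))"
        proof (intro expressible_disj expressible_bex expressible_conj expressible_ball
            expressible_map_eq expressible_rel)
          fix x j assume "x \<in> X" "j \<in> {..<n}"
          then show "expressible (case_sum \<tau> schema) N ?C (\<lambda>D J \<sigma>.
            wit D ((J \<circ> Inl)(S := insert (map \<sigma> [0..<n]) (J (Inl S)))) (X - {x}) T (\<sigma> \<circ> \<rho>(x := j)))"
            using psubset.prems \<open>n \<le> N\<close> by (intro psubset.IH) (auto simp: set_vars)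
        next
          fix Z zs assume "Z \<in> Pow B" "zs \<in> Z"
          then have "set zs \<subseteq> set (vars X)"
            using atoms_fv[OF qf, of S zs] fv_g by (fastforce simp: B_def set_vars)
          then show "set (map \<rho> zs) \<subseteq> {..<N}" using psubset.prems by auto
        next
          fix Z assume "Z \<in> Pow B"
          then show "finite Z" using \<open>finite B\<close> finite_subset by blast
        next
          fix Z assume "Z \<in> Pow B"
          then show "case_sum \<tau> schema (Inr (code (X, T \<union> Pair S ` Z))) = Some (length (map \<rho> (vars X)))"
            using schema_code[OF key] by simp
        qed (use \<open>finite X\<close> \<open>finite B\<close> \<open>n \<le> N\<close> psubset.prems in auto)
      next
        fix D J and \<sigma> :: "nat \<Rightarrow> 'a"
        assume C: "?C D J \<sigma>"
        have "set (map \<sigma> [0..<n]) \<subseteq> D" using C \<open>n \<le> N\<close> by auto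
        note ins = wit_insert[OF this, of "J \<circ> Inl" S X T "\<sigma> \<circ> \<rho>"]
        \<comment> \<open>Giving \<open>x\<close> the \<open>j\<close>-th entry of the inserted
          tuple amounts to renaming \<open>x\<close> to the variable \<open>j\<close>.\<close>
        have upd: "(\<sigma> \<circ> \<rho>)(x := map \<sigma> [0..<n] ! j) = \<sigma> \<circ> \<rho>(x := j)" if "j < n" for x j
          using that by (auto simp: fun_eq_iff)
        have A: "(\<exists>x\<in>X. \<exists>j\<in>{..<n}. wit D ((J \<circ> Inl)(S := insert (map \<sigma> [0..<n]) (J (Inl S))))
             (X - {x}) T (\<sigma> \<circ> \<rho>(x := j))) \<longleftrightarrow>
          (\<exists>x\<in>X. \<exists>j\<in>{..<length (map \<sigma> [0..<n])}.
             wit D ((J \<circ> Inl)(S := insert (map \<sigma> [0..<n]) ((J \<circ> Inl) S))) (X - {x}) T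
               ((\<sigma> \<circ> \<rho>)(x := map \<sigma> [0..<n] ! j)))"
          by (intro bex_cong) (simp_all only: upd lessThan_iff length_map length_upt diff_zero comp_apply)
        have key_iff: "map \<sigma> (map \<rho> (vars X)) \<in> J (Inr (code (X, T \<union> Pair S ` Z)))
          \<longleftrightarrow> wit D (J \<circ> Inl) X (T \<union> Pair S ` Z) (\<sigma> \<circ> \<rho>)" if "Z \<subseteq> B" for Z
        proof -
          have "(\<sigma> \<circ> \<rho>) ` set (vars X) \<subseteq> D" using C psubset.prems(2) by auto
          note map_vars_in_aux_db[OF key[OF that] this, of "J \<circ> Inl"]
          moreover have "J (Inr c) = aux_db D (J \<circ> Inl) c" for c
            using fun_cong[OF conjunct2[OF C], of c] by (simp only: comp_apply)
          ultimately show ?thesis by (simp only: map_map)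
        qed
        have B: "(\<exists>Z\<in>Pow B. (\<forall>zs\<in>Z. map \<sigma> (map \<rho> zs) = map \<sigma> [0..<n]) \<and>
             map \<sigma> (map \<rho> (vars X)) \<in> J (Inr (code (X, T \<union> Pair S ` Z)))) \<longleftrightarrow>
          (\<exists>Z\<in>Pow B. (\<forall>zs\<in>Z. map (\<sigma> \<circ> \<rho>) zs = map \<sigma> [0..<n]) \<and>
             wit D (J \<circ> Inl) X (T \<union> Pair S ` Z) (\<sigma> \<circ> \<rho>))"
          by (intro bex_cong refl) (simp only: key_iff[unfolded map_map] Pow_iff map_map)
        show "(\<exists>x\<in>X. \<exists>j\<in>{..<n}. wit D ((J \<circ> Inl)(S := insert (map \<sigma> [0..<n]) (J (Inl S))))
             (X - {x}) T (\<sigma> \<circ> \<rho>(x := j))) \<or>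
          (\<exists>Z\<in>Pow B. (\<forall>zs\<in>Z. map \<sigma> (map \<rho> zs) = map \<sigma> [0..<n]) \<and>
             map \<sigma> (map \<rho> (vars X)) \<in> J (Inr (code (X, T \<union> Pair S ` Z))))
          \<longleftrightarrow> wit D ((J \<circ> Inl)(S := insert (map \<sigma> [0..<n]) (J (Inl S)))) X T (\<sigma> \<circ> \<rho>)"
          unfolding A B using ins[folded B_def] by (simp only: comp_apply)
      qed
    qed
  qed
qed

text \<open>The type argument fixes the element type of the databases, which the type of
  \<open>f\<close> does not mention.\<close>

definition is_update :: "nat \<Rightarrow> 'r \<Rightarrow> ('r + nat) fo \<Rightarrow> 'a itself \<Rightarrow> bool" where
  "is_update R S f _ \<longleftrightarrow>
     (let n = the (\<tau> S); m = the (schema R) in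
      quantifier_free f \<and> over_schema (case_sum \<tau> schema) f \<and> fv f \<subseteq> {..<n + m} \<and>
      (\<forall>D (I :: ('r, 'a) db) a. \<forall>b\<in>tuples D m. a \<in> tuples D n \<longrightarrow>
         (sat D (case_sum I (aux_db D I)) ((!) (a @ b)) f \<longleftrightarrow> b \<in> aux_db D (I(S := insert a (I S))) R)))"

lemma is_update_exists:
  assumes "schema R = Some m" "\<tau> S = Some n"
  shows "\<exists>f. is_update R S f TYPE('a)"
proof -
  obtain X T where key: "(X, T) \<in> keys" and R: "R = code (X, T)"
    using assms by (auto simp: schema_def split: if_splits)
  have m: "m = length (vars X)" using assms key R schema_code by simp
  \<comment> \<open>The prefix before \<open>v\<close> has the position of \<open>v\<close> in
    \<open>vars X\<close> as its length; the shift by \<open>n\<close> skips the inserted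
    tuple.\<close>
  define \<rho> where "\<rho> v = n + length (takeWhile (\<lambda>w. w \<noteq> v) (vars X))" for v
  have less: "length (takeWhile (\<lambda>w. w \<noteq> v) (vars X)) < m" if "v \<in> set (vars X)" for v
    unfolding m using that
    by (metis (full_types) length_takeWhile_le nat_less_le take_all_iff takeWhile_eq_all_conv takeWhile_eq_take)
  have "X \<subseteq> set xs" "T \<subseteq> atoms g" "\<rho> ` set (vars X) \<subseteq> {..<n + m}"
    using key less by (auto simp: keys_def \<rho>_def)
  from expressible_wit_insert[OF assms(2) le_add1 this, where ?'a = 'a]
  obtain f where f: "quantifier_free f" "over_schema (case_sum \<tau> schema) f" "fv f \<subseteq> {..<n + m}"
    and sat: "\<forall>D J \<sigma>. \<sigma> ` {..<n + m} \<subseteq> D \<and> J \<circ> Inr = aux_db D (J \<circ> Inl) \<longrightarrow>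
      (sat D J \<sigma> f \<longleftrightarrow>
        wit D ((J \<circ> Inl)(S := insert (map \<sigma> [0..<n]) (J (Inl S)))) X T ((\<sigma> :: nat \<Rightarrow> 'a) \<circ> \<rho>))"
    unfolding expressible_def by (elim exE conjE)
  have "sat D (case_sum I (aux_db D I)) ((!) (a @ b)) f \<longleftrightarrow> b \<in> aux_db D (I(S := insert a (I S))) R"
    if ab: "b \<in> tuples D m" "a \<in> tuples D n" for D :: "'a set" and I a b
  proof -
    have len: "length a = n" "length b = m" and D: "set a \<subseteq> D" "set b \<subseteq> D"
      using ab by (auto simp: tuples_def)
    have img: "(!) (a @ b) ` {..<n + m} \<subseteq> D"
      using len D by (auto simp: nth_append subset_iff)
    have a: "map ((!) (a @ b)) [0..<n] = a"
      using len by (auto simp: list_eq_iff_nth_eq nth_append)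
    have b: "map ((!) (a @ b) \<circ> \<rho>) (vars X) = b"
    proof (rule nth_equalityI)
      fix i assume "i < length (map ((!) (a @ b) \<circ> \<rho>) (vars X))"
      then have i: "i < m" by (simp add: m)
      \<comment> \<open>The first position of the entry \<open>vars X ! i\<close>, which is
        \<open>i\<close> itself by distinctness.\<close>
      let ?j = "length (takeWhile (\<lambda>w. w \<noteq> vars X ! i) (vars X))"
      have "?j < m" using less i m by simp
      moreover have "vars X ! ?j = vars X ! i"
        using nth_length_takeWhile[of "\<lambda>w. w \<noteq> vars X ! i" "vars X"] \<open>?j < m\<close> m by simp
      ultimately have "?j = i" using distinct_vars i m nth_eq_iff_index_eq by blast
      then show "map ((!) (a @ b) \<circ> \<rho>) (vars X) ! i = b ! i"
        using i len by (simp add: m[symmetric] \<rho>_def nth_append)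
    qed (simp add: len m)
    have "((!) (a @ b) \<circ> \<rho>) ` set (vars X) \<subseteq> D"
      using b D by (metis list.set_map)
    from map_vars_in_aux_db[OF key this, of "I(S := insert a (I S))", unfolded b, folded R]
    show ?thesis
      using sat[rule_format, of "(!) (a @ b)" D "case_sum I (aux_db D I)", unfolded a] img
      by (simp only: case_sum_o_inj sum.case simp_thms)
  qed
  with f assms have "is_update R S f TYPE('a)" by (simp add: is_update_def Let_def)
  then show ?thesis ..
qed

section \<open>The dynamic program\<close>

text \<open>Deletions get the quantifier-free dummy \<open>Bot\<close>, as correctness is claimed
  for insertions only. The query is the relation with all of \<open>xs\<close> quantified and no
  atom forced.\<close>

definition program :: "('r, 'a) dyn_program" where
  "program = \<lparr>aux = schema,
     update = (\<lambda>R \<delta>. case \<delta> of Ins S \<Rightarrow> (SOME f. is_update R S f TYPE('a)) | Del S \<Rightarrow> Bot),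
     init = aux_db, query_sym = code (set xs, {})\<rparr>"

lemma is_update_program:
  assumes "schema R = Some m" "\<tau> S = Some n"
  shows "is_update R S (update (program :: ('r, 'a) dyn_program) R (Ins S)) TYPE('a)"
  using someI_ex[OF is_update_exists[OF assms]] by (simp add: program_def)

text \<open>For \<open>k = 0\<close> the first component is empty and the pair is a key through the
  exception \<open>xs = []\<close>.\<close>

lemma query_key: "(set xs, {}) \<in> keys"
  by (auto simp: keys_def)

lemma is_dyn_program_program: "is_dyn_program \<tau> (program :: ('r, 'a) dyn_program)"
proof -
  have "finite (dom schema)"
    by (rule finite_subset[of _ "code ` keys"]) (auto simp: schema_def finite_keys split: if_splits)
  moreover have "over_schema (case_sum \<tau> schema) (update (program :: ('r, 'a) dyn_program) R \<delta>) \<and>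
      fv (update (program :: ('r, 'a) dyn_program) R \<delta>) \<subseteq> {..<n + m}"
    if "schema R = Some m" "\<tau> (op_sym \<delta>) = Some n" for R m \<delta> n
  proof (cases \<delta>)
    case (Ins S)
    then show ?thesis using is_update_program[of R m S n, where ?'a = 'a] that by (simp add: is_update_def)
  qed (simp add: program_def)
  moreover have "is_db schema D (aux_db D I)" for D and I :: "('r, 'a) db"
    using aux_db_subset unfolding is_db_def by (fastforce split: option.splits)
  ultimately show ?thesis
    using schema_code[OF query_key] by (auto simp: is_dyn_program_def program_def)
qed

lemma quantifier_free_program_program:
  "quantifier_free_program \<tau> (program :: ('r, 'a) dyn_program)"
proof -
  have "quantifier_free (update (program :: ('r, 'a) dyn_program) R \<delta>)"
    if "schema R = Some m" "\<tau> (op_sym \<delta>) = Some n" for R m \<delta> n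
  proof (cases \<delta>)
    case (Ins S)
    then show ?thesis using is_update_program[of R m S n, where ?'a = 'a] that by (simp add: is_update_def Let_def)
  qed (simp add: program_def)
  then show ?thesis by (auto simp: quantifier_free_program_def program_def)
qed

text \<open>A nonempty \<open>X\<close> removes at least one column out of \<open>l + k\<close>.
  Without quantifiers the arity is \<open>l\<close>, while \<open>l + 0 - 1\<close> is smaller for
  positive \<open>l\<close>; hence the maximum.\<close>

lemma ary_program_program: "ary_program (max l (l + length xs - 1)) program"
proof -
  have "length (vars X) \<le> max l (l + length xs - 1)" if "(X, T) \<in> keys" for X T
  proof (cases "xs = []")
    case False
    then have "\<exists>x\<in>set xs. x \<in> X" using that by (auto simp: keys_def)
    then have "length (filter (\<lambda>x. x \<notin> X) xs) < length xs"
      by (auto intro: length_filter_less)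
    then show ?thesis by (simp add: vars_def)
  next
    case True
    then show ?thesis unfolding vars_def by simp
  qed
  then show ?thesis
    by (auto simp: ary_program_def program_def ran_def schema_def decode_code split: if_splits)
qed

text \<open>The invariant: formulas evaluated in the old state produce the intended contents for the
  new database.\<close>

lemma step_program:
  fixes I :: "('r, 'a) db"
  assumes "is_modification \<tau> D (Ins S, a)"
  shows "step program D (Ins S, a) (I, aux_db D I) =
    (modify (Ins S, a) I, aux_db D (modify (Ins S, a) I))"
proof -
  obtain n where n: "\<tau> S = Some n" "a \<in> tuples D n"
    using assms by (auto simp: is_modification_def)
  have "(case schema R of None \<Rightarrow> {} | Some m \<Rightarrow> {b \<in> tuples D m.
      sat D (case_sum I (aux_db D I)) ((!) (a @ b)) (update (program :: ('r, 'a) dyn_program) R (Ins S))}) =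
    aux_db D (I(S := insert a (I S))) R" for R
  proof (cases "schema R")
    case None
    then show ?thesis using aux_db_subset[of D _ R] by auto
  next
    case (Some m)
    then show ?thesis
      using is_update_program[OF Some n(1), where ?'a = 'a] n aux_db_subset[of D "I(S := insert a (I S))" R]
      by (auto simp: is_update_def)
  qed
  moreover have "aux (program :: ('r, 'a) dyn_program) = schema"
    by (simp add: program_def)
  ultimately show ?thesis by (simp add: step_def)
qed

lemma fold_step_program:
  assumes "\<forall>m\<in>set \<alpha>. is_modification \<tau> D m \<and> is_Ins (fst m)"
  shows "fold (step program D) \<alpha> (I, aux_db D I) = (fold modify \<alpha> I, aux_db D (fold modify \<alpha> I))"
  using assms
proof (induction \<alpha> arbitrary: I)
  case (Cons m \<alpha>)
  obtain S a where "m = (Ins S, a)" using Cons.prems by (cases m) (auto simp: is_Ins_def)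
  with Cons show ?case by (simp add: step_program del: modify.simps)
qed simp

lemma aux_db_query: "aux_db D I (code (set xs, {})) = answers (foldr Ex xs g) l D I"
proof -
  have vars: "vars (set xs) = [0..<l]" by (simp add: vars_def)
  have "wit D I (set xs) {} \<sigma> \<longleftrightarrow> sat D I \<sigma> (foldr Ex xs g)" for \<sigma>
  proof
    assume "wit D I (set xs) {} \<sigma>"
    then obtain \<sigma>' where s: "\<forall>v\<in>fv g - set xs. \<sigma>' v = \<sigma> v" "\<sigma>' ` set xs \<subseteq> D"
      and h: "holds (\<lambda>R zs. map \<sigma>' zs \<in> I R) \<sigma>' g"
      unfolding wit_def by auto
    \<comment> \<open>The quantifier block demands agreement with \<open>\<sigma>\<close> on every
      variable outside \<open>xs\<close>, whereas \<open>wit\<close> ensures it only on those free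
      in \<open>g\<close>.\<close>
    define \<sigma>'' where "\<sigma>'' v = (if v \<in> set xs then \<sigma>' v else \<sigma> v)" for v
    have eq: "\<sigma>' v = \<sigma>'' v" if "v \<in> fv g" for v
      using s that by (auto simp: \<sigma>''_def)
    have "map \<sigma>' zs = map \<sigma>'' zs" if "(R, zs) \<in> atoms g" for R zs
      using atoms_fv[OF qf that] eq by auto
    with eq have "holds (\<lambda>R zs. map \<sigma>'' zs \<in> I R) \<sigma>'' g"
      by (intro holds_mono[OF qf pos h]) metis+
    then have "sat D I \<sigma>'' g" by (simp add: sat_iff_holds[OF qf])
    then show "sat D I \<sigma> (foldr Ex xs g)"
      unfolding sat_foldr_Ex using s by (intro exI[of _ \<sigma>'']) (auto simp: \<sigma>''_def)
  next
    assume "sat D I \<sigma> (foldr Ex xs g)"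
    then show "wit D I (set xs) {} \<sigma>"
      unfolding sat_foldr_Ex wit_def sat_iff_holds[OF qf] by auto
  qed
  note wit = this
  show ?thesis
  proof (rule set_eqI)
    fix b
    show "b \<in> aux_db D I (code (set xs, {})) \<longleftrightarrow> b \<in> answers (foldr Ex xs g) l D I"
    proof (cases "b \<in> tuples D l")
      case True
      then have b: "map ((!) b) [0..<l] = b" "(!) b ` {..<l} \<subseteq> D"
        by (auto simp: tuples_def list_eq_iff_nth_eq)
      then show ?thesis
        using map_vars_in_aux_db[OF query_key, of "(!) b" D I] True
        by (simp add: vars wit answers_def atLeast0LessThan)
    next
      case False
      then show ?thesis
        using aux_db_subset[of D I "code (set xs, {})"] schema_code[OF query_key]
        by (auto simp: answers_def vars)
    qed
  qed
qed

end

section \<open>From the fixed formula to arbitrary queries\<close>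

lemma is_db_modify_Ins:
  "is_db \<tau> D I \<Longrightarrow> is_modification \<tau> D (Ins S, a) \<Longrightarrow> is_db \<tau> D (modify (Ins S, a) I)"
  unfolding is_db_def is_modification_def by (fastforce split: option.splits)

text \<open>Required because the formula is known to define the query only on databases over the
  schema.\<close>

lemma is_db_fold_modify:
  assumes "is_db \<tau> D I" "\<forall>m\<in>set \<alpha>. is_modification \<tau> D m \<and> is_Ins (fst m)"
  shows "is_db \<tau> D (fold modify \<alpha> I)"
  using assms
proof (induction \<alpha> arbitrary: I)
  case (Cons m \<alpha>)
  obtain S a where "m = (Ins S, a)" using Cons.prems by (cases m) (auto simp: is_Ins_def)
  with Cons show ?case by (simp add: is_db_modify_Ins del: modify.simps)
qed simp

lemma over_schema_foldr_Ex: "over_schema \<tau> (foldr Ex xs g) \<longleftrightarrow> over_schema \<tau> g"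
  by (induction xs) auto

theorem theorem4p1:
  fixes \<tau> :: "'r schema" and q :: "('r, 'a) query" and l k :: nat
  assumes "semi_positive_existential_query \<tau> l k q"
  shows "in_DynProp_under_insertions (max l (l + k - 1)) \<tau> l q"
proof -
  obtain f where f: "semi_positive_existential l k f" "over_schema \<tau> f"
    and q: "\<forall>D I. finite D \<and> is_db \<tau> D I \<longrightarrow> q D I = answers f l D I"
    using assms unfolding semi_positive_existential_query_def by (elim exE conjE)
  from f(1) obtain xs g where f_eq: "f = foldr Ex xs g" and k: "length xs = k"
    and xs: "distinct xs" "set xs \<inter> {..<l} = {}" "quantifier_free g" "semi_positive g"
      "fv g \<subseteq> set xs \<union> {..<l}"
    unfolding semi_positive_existential_def by (elim exE conjE)
  have "over_schema \<tau> g" using f(2) unfolding f_eq over_schema_foldr_Ex .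
  \<comment> \<open>A numbering \<open>code\<close> exists because a formula has only finitely many
    variables and atoms.\<close>
  have "finite (Pow (set xs) \<times> Pow (atoms g))" by simp
  then obtain code :: "nat set \<times> ('r \<times> nat list) set \<Rightarrow> nat"
    where "inj_on code (Pow (set xs) \<times> Pow (atoms g))"
    by (rule finite_imp_inj_to_nat_seg[elim_format]) blast
  with xs \<open>over_schema \<tau> g\<close> interpret existential_query \<tau> l xs g code by unfold_locales
  let ?P = "program :: ('r, 'a) dyn_program"
  have P: "init ?P = aux_db" "query_sym ?P = code (set xs, {})" "aux ?P = schema"
    by (simp_all add: program_def)
  have "maintains_under_insertions \<tau> ?P q"
    unfolding maintains_for_def P
    by (simp add: fold_step_program aux_db_query q is_db_fold_modify f_eq)
  moreover have "aux ?P (query_sym ?P) = Some l"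
    unfolding P schema_code[OF query_key] by (simp add: vars_def)
  ultimately show ?thesis
    using is_dyn_program_program quantifier_free_program_program ary_program_program k
    unfolding in_DynProp_under_insertions_def by blast
qed

end
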